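(* Let $k\ge 1$ and $m\ge 1$ be integers. For any tree $T$ of order $m$, every $k$-connected cograph $G$ with $\delta(G)\ge k+m-1$ contains a subtree $T'\cong T$ such that $G-E(T')$ is $k$-connected.
   Context: Graphs are finite, simple and undirected. The order of a graph is its number of vertices; $\delta(G)$ is the minimum degree. Cographs are defined recursively: $K_1$ is a cograph; the disjoint union of cographs is a cograph; the join of cographs is a cograph, where the join $G_1+G_2$ of vertex-disjoint graphs is obtained from their disjoint union by adding all edges between $V(G_1)$ and $V(G_2)$. (Equivalently, cographs are the graphs with no induced path $P_4$ on four vertices.) The connectivity $\kappa(G)$ is the minimum number of vertices whose removal from $G$ results in a disconnected graph or a trivial graph (a graph of order 1); in particular $\kappa(K_1)=0$. $G$ is $k$-connected if $\kappa(G)\ge k$, with the additional convention that $K_1$ is regarded as 1-connected. For $F\subseteq E(G)$, $G-F$ is the graph obtained by deleting all edges of $F$ (keeping all vertices). A subtree of $G$ is a (not necessarily induced) subgraph that is a tree. *)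

theory Defs
  imports Main
begin

text \<open>A graph is a pair of a vertex set and a set of edges, an edge being a two-element set of
  vertices. The graph without vertices is admitted here so that vertex sets can be deleted freely;
  trees and cographs are non-empty.\<close>

type_synonym 'a ugraph = "'a set \<times> 'a set set"

abbreviation verts :: "'a ugraph \<Rightarrow> 'a set" where
  "verts G \<equiv> fst G"

abbreviation edges :: "'a ugraph \<Rightarrow> 'a set set" where
  "edges G \<equiv> snd G"

definition simple_graph :: "'a ugraph \<Rightarrow> bool" where
  "simple_graph G \<longleftrightarrow> finite (verts G) \<and> (\<forall>e\<in>edges G. e \<subseteq> verts G \<and> card e = 2)"

definition adjacent :: "'a ugraph \<Rightarrow> 'a \<Rightarrow> 'a \<Rightarrow> bool" where
  "adjacent G u v \<longleftrightarrow> {u, v} \<in> edges G"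

definition degree :: "'a ugraph \<Rightarrow> 'a \<Rightarrow> nat" where
  "degree G v = card {u \<in> verts G. adjacent G u v}"

definition min_degree :: "'a ugraph \<Rightarrow> nat" where
  "min_degree G = Min (degree G ` verts G)"

definition subgraph :: "'a ugraph \<Rightarrow> 'a ugraph \<Rightarrow> bool" where
  "subgraph H G \<longleftrightarrow> verts H \<subseteq> verts G \<and> edges H \<subseteq> edges G"

definition isomorphic :: "'a ugraph \<Rightarrow> 'b ugraph \<Rightarrow> bool" where
  "isomorphic G H \<longleftrightarrow> (\<exists>f. bij_betw f (verts G) (verts H) \<and>
     (\<forall>u\<in>verts G. \<forall>v\<in>verts G. adjacent G u v \<longleftrightarrow> adjacent H (f u) (f v)))"

definition delete_verts :: "'a ugraph \<Rightarrow> 'a set \<Rightarrow> 'a ugraph" where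
  "delete_verts G S = (verts G - S, {e \<in> edges G. e \<inter> S = {}})"

definition delete_edges :: "'a ugraph \<Rightarrow> 'a set set \<Rightarrow> 'a ugraph" where
  "delete_edges G F = (verts G, edges G - F)"

definition graph_connected :: "'a ugraph \<Rightarrow> bool" where
  "graph_connected G \<longleftrightarrow> (\<forall>u\<in>verts G. \<forall>v\<in>verts G. (adjacent G)\<^sup>*\<^sup>* u v)"

text \<open>A cycle is given by the list of its vertices, without repetition of the starting point.\<close>

definition cycle :: "'a ugraph \<Rightarrow> 'a list \<Rightarrow> bool" where
  "cycle G vs \<longleftrightarrow> length vs \<ge> 3 \<and> distinct vs \<and> set vs \<subseteq> verts G \<and>
     (\<forall>i. Suc i < length vs \<longrightarrow> adjacent G (vs ! i) (vs ! Suc i)) \<and> adjacent G (last vs) (hd vs)"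

definition tree :: "'a ugraph \<Rightarrow> bool" where
  "tree T \<longleftrightarrow> simple_graph T \<and> verts T \<noteq> {} \<and> graph_connected T \<and> (\<nexists>vs. cycle T vs)"

definition graph_union :: "'a ugraph \<Rightarrow> 'a ugraph \<Rightarrow> 'a ugraph" where
  "graph_union G H = (verts G \<union> verts H, edges G \<union> edges H)"

definition graph_join :: "'a ugraph \<Rightarrow> 'a ugraph \<Rightarrow> 'a ugraph" where
  "graph_join G H = (verts G \<union> verts H,
     edges G \<union> edges H \<union> {{u, v} | u v. u \<in> verts G \<and> v \<in> verts H})"

inductive cograph :: "'a ugraph \<Rightarrow> bool" where
  cograph_K1: "cograph ({v}, {})"
| cograph_union: "cograph G \<Longrightarrow> cograph H \<Longrightarrow> verts G \<inter> verts H = {} \<Longrightarrow> cograph (graph_union G H)"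
| cograph_join: "cograph G \<Longrightarrow> cograph H \<Longrightarrow> verts G \<inter> verts H = {} \<Longrightarrow> cograph (graph_join G H)"

text \<open>For a non-empty finite graph a set \<open>S\<close> as below exists: all vertices but one.
  Deleting all vertices does not count, since the empty graph satisfies \<^const>\<open>graph_connected\<close>
  and does not have order 1.\<close>

definition connectivity :: "'a ugraph \<Rightarrow> nat" where
  "connectivity G = (LEAST n. \<exists>S \<subseteq> verts G. card S = n \<and>
     (\<not> graph_connected (delete_verts G S) \<or> card (verts (delete_verts G S)) = 1))"

text \<open>By convention the graph of order 1, whose connectivity is 0, is 1-connected.\<close>

definition k_connected :: "nat \<Rightarrow> 'a ugraph \<Rightarrow> bool" where
  "k_connected k G \<longleftrightarrow> connectivity G \<ge> k \<or> (k = 1 \<and> card (verts G) = 1)"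

lemma cograph_simple_graph:
  assumes "cograph G"
  shows "simple_graph G \<and> verts G \<noteq> {}"
  using assms
proof induction
  case (cograph_K1 v)
  then show ?case by (simp add: simple_graph_def)
next
  case (cograph_union G H)
  then show ?case by (auto simp: simple_graph_def graph_union_def)
next
  case (cograph_join G H)
  have fin: "finite (verts G)" "finite (verts H)" "verts G \<noteq> {}"
    using cograph_join.IH by (auto simp: simple_graph_def)
  have joined: "e \<subseteq> verts (graph_join G H) \<and> card e = 2" if e: "e \<in> edges (graph_join G H)" for e
  proof -
    consider "e \<in> edges G" | "e \<in> edges H" | u v where "e = {u, v}" "u \<in> verts G" "v \<in> verts H"
      using e unfolding graph_join_def by auto
    then show ?thesis
    proof cases
      case 1
      then show ?thesis using cograph_join.IH(1) by (auto simp: simple_graph_def graph_join_def)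
    next
      case 2
      then show ?thesis using cograph_join.IH(2) by (auto simp: simple_graph_def graph_join_def)
    next
      case (3 u v)
      then have "u \<noteq> v" using cograph_join.hyps by blast
      with 3 show ?thesis by (simp add: graph_join_def)
    qed
  qed
  from fin joined show ?case unfolding simple_graph_def by (simp add: graph_join_def)
qed

lemma connectivity_K1: "connectivity ({v}, {}) = 0"
proof -
  have "\<exists>S \<subseteq> verts ({v}, {}). card S = 0 \<and>
     (\<not> graph_connected (delete_verts ({v}, {}) S) \<or> card (verts (delete_verts ({v}, {}) S)) = 1)"
    by (rule exI[of _ "{}"]) (simp add: delete_verts_def)
  then show ?thesis
    unfolding connectivity_def by (rule Least_eq_0)
qed

end

theory Submission
  imports Defs
begin

text \<open>Every copy \<open>T'\<close> of \<open>T\<close> in \<open>G\<close> works, and one exists by greedy embedding. Suppose deleting fewer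
  than \<open>k\<close> vertices \<open>S\<close> from \<open>G - E(T')\<close> leaves a vertex set split into non-empty parts \<open>A\<close>, \<open>B\<close>
  without edges between them. Every edge of \<open>G\<close> between \<open>A\<close> and \<open>B\<close> belongs to \<open>T'\<close>. If \<open>A \<subseteq> V(T')\<close>,
  then a vertex \<open>x \<in> A\<close> has all its neighbours in \<open>S \<union> (V(T') - {x})\<close>, hence at most \<open>k + m - 2\<close>
  of them, which is impossible. So \<open>A\<close>, and likewise \<open>B\<close>, contains a vertex outside \<open>T'\<close>, and such a
  vertex has no neighbour in \<open>G\<close> on the other side. But \<open>G - S\<close> is a connected cograph, hence a
  join of two non-empty graphs, and the existence of such vertices on both sides forces one of the
  two factors to be empty.\<close>

section \<open>Adjacency, paths and cycles\<close>

lemma adjacent_sym: "adjacent G u v \<Longrightarrow> adjacent G v u"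
  by (simp add: adjacent_def insert_commute)

lemma adjacent_verts:
  assumes "simple_graph G" "adjacent G u v"
  shows "u \<in> verts G" "v \<in> verts G" "u \<noteq> v"
  using assms by (auto simp: simple_graph_def adjacent_def card_2_iff)

lemma adjacent_delete_verts:
  "adjacent (delete_verts G S) u v \<longleftrightarrow> adjacent G u v \<and> u \<notin> S \<and> v \<notin> S"
  by (auto simp: adjacent_def delete_verts_def)

text \<open>The path is built backwards from \<open>y\<close>. If the vertex to be prepended already
  occurs, the part before its occurrence is cut off. Distinctness is what later allows the path to
  be closed to a \<open>cycle\<close>.\<close>

lemma rtranclp_imp_distinct_path:
  assumes "R\<^sup>*\<^sup>* x y"
  shows "\<exists>vs. vs \<noteq> [] \<and> hd vs = x \<and> last vs = y \<and> distinct vs \<and> successively R vs"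
  using assms
proof (induction rule: converse_rtranclp_induct)
  case base
  show ?case by (rule exI[of _ "[y]"]) simp
next
  case (step x z)
  then obtain vs where vs: "vs \<noteq> []" "hd vs = z" "last vs = y" "distinct vs" "successively R vs"
    by blast
  show ?case
  proof (cases "x \<in> set vs")
    case True
    then obtain ys zs where "vs = ys @ x # zs" by (meson split_list)
    with vs have "last (x # zs) = y" "distinct (x # zs)" "successively R (x # zs)"
      by (auto simp: successively_append_iff)
    then show ?thesis by (intro exI[of _ "x # zs"]) auto
  next
    case False
    with vs step(1) show ?thesis
      by (intro exI[of _ "x # vs"]) (auto simp: successively_Cons)
  qed
qed

lemma cycle_iff_successively:
  "cycle G vs \<longleftrightarrow> length vs \<ge> 3 \<and> distinct vs \<and> set vs \<subseteq> verts G \<and>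
     successively (adjacent G) vs \<and> adjacent G (last vs) (hd vs)"
  unfolding cycle_def successively_conv_nth by blast

text \<open>A path inside \<open>U\<close> between two different neighbours of \<open>v\<close>
  would close to a cycle through \<open>v\<close>. In the greedy embedding this leaves a new vertex
  with just one edge to realise.\<close>

lemma acyclic_unique_neighbour:
  assumes T: "simple_graph T" "\<nexists>vs. cycle T vs"
    and conn: "(\<lambda>x y. adjacent T x y \<and> x \<in> U \<and> y \<in> U)\<^sup>*\<^sup>* u u'"
    and v: "v \<notin> U" "adjacent T u v" "adjacent T u' v" and u: "u \<in> U"
  shows "u = u'"
proof (rule ccontr)
  assume ne: "u \<noteq> u'"
  let ?R = "\<lambda>x y. adjacent T x y \<and> x \<in> U \<and> y \<in> U"
  obtain vs where vs: "vs \<noteq> []" "hd vs = u" "last vs = u'" "distinct vs" "successively ?R vs"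
    using rtranclp_imp_distinct_path[OF conn] by blast
  have succ: "successively (adjacent T) vs" "successively (\<lambda>x y. x \<in> U \<and> y \<in> U) vs"
    using vs(5) by (auto elim: successively_mono)
  \<comment> \<open>\<open>successively\<close> is vacuous on a one-element list; there membership
    in \<open>U\<close> comes from the head \<open>u\<close>.\<close>
  have "set vs \<subseteq> U"
    using succ(2) vs(1,2) u
  proof (induction vs arbitrary: u)
    case (Cons a vs)
    then show ?case by (cases vs) auto
  qed simp
  \<comment> \<open>Different ends force at least two entries, so \<open>v # vs\<close> has the
    length 3 that a cycle requires.\<close>
  moreover obtain a b cs where "vs = a # b # cs"
    using vs(1-3) ne by (metis last_ConsL list.exhaust list.sel(1))
  moreover have "x \<in> verts T" if "x \<in> set vs" for x
  proof -
    obtain i where i: "i < length vs" "x = vs ! i" using \<open>x \<in> set vs\<close> by (metis in_set_conv_nth)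
    show ?thesis
    proof (cases i)
      case 0
      then show ?thesis using i vs(1,2) adjacent_verts(1)[OF T(1) v(2)] by (simp add: hd_conv_nth)
    next
      case (Suc j)
      then show ?thesis using i succ(1) adjacent_verts(2)[OF T(1)]
        by (auto simp: successively_conv_nth)
    qed
  qed
  ultimately have "cycle T (v # vs)"
    using vs succ(1) v adjacent_verts[OF T(1) v(2)] adjacent_sym[of T u v]
    by (auto simp: cycle_iff_successively)
  then show False using T(2) by blast
qed

section \<open>Greedy embedding of a tree\<close>

lemma rtranclp_leaves_set:
  assumes "R\<^sup>*\<^sup>* x y" "x \<in> U" "y \<notin> U"
  obtains u v where "R u v" "u \<in> U" "v \<notin> U"
  using assms by (induction rule: rtranclp_induct) auto

lemma tree_embedding_partial:
  assumes T: "tree T" and G: "simple_graph G" "verts G \<noteq> {}"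
    and deg: "\<forall>v\<in>verts G. degree G v + 1 \<ge> card (verts T)"
    and n: "1 \<le> n" "n \<le> card (verts T)"
  shows "\<exists>U f. U \<subseteq> verts T \<and> card U = n \<and>
    (\<forall>x\<in>U. \<forall>y\<in>U. (\<lambda>x y. adjacent T x y \<and> x \<in> U \<and> y \<in> U)\<^sup>*\<^sup>* x y) \<and>
    inj_on f U \<and> f ` U \<subseteq> verts G \<and>
    (\<forall>x\<in>U. \<forall>y\<in>U. adjacent T x y \<longrightarrow> adjacent G (f x) (f y))"
  using n
proof (induction n rule: dec_induct)
  case base
  obtain t g where tg: "t \<in> verts T" "g \<in> verts G" using T G by (auto simp: tree_def)
  have "\<not> adjacent T t t" using T adjacent_verts(3) by (metis tree_def)
  with tg show ?case
    by (intro exI[of _ "{t}"] exI[of _ "\<lambda>_. g"]) simp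
next
  case (step n)
  let ?R = "\<lambda>U x y. adjacent T x y \<and> x \<in> U \<and> y \<in> U"
  have sT: "simple_graph T" and acyc: "\<nexists>vs. cycle T vs" and finT: "finite (verts T)"
    using T by (auto simp: tree_def simple_graph_def)
  obtain U f where U: "U \<subseteq> verts T" "card U = n"
      and conn: "\<And>x y. x \<in> U \<Longrightarrow> y \<in> U \<Longrightarrow> (?R U)\<^sup>*\<^sup>* x y"
      and f: "inj_on f U" "f ` U \<subseteq> verts G"
      and hom: "\<And>x y. x \<in> U \<Longrightarrow> y \<in> U \<Longrightarrow> adjacent T x y \<Longrightarrow> adjacent G (f x) (f y)"
    using step.IH step.prems by auto
  have finU: "finite U" using U finT finite_subset by blast
  have "U \<noteq> {}" using U(2) step.hyps by auto
  then obtain x where x: "x \<in> U" by blast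
  have "U \<noteq> verts T" using U(2) step.prems by auto
  then obtain y where y: "y \<in> verts T" "y \<notin> U" using U(1) by blast
  \<comment> \<open>A walk from \<open>x\<close> to \<open>y\<close> leaves \<open>U\<close> along
    some edge; its outer end \<open>v\<close> is embedded next.\<close>
  have "(adjacent T)\<^sup>*\<^sup>* x y" using T x y U(1) by (auto simp: tree_def graph_connected_def)
  then obtain u v where uv: "adjacent T u v" "u \<in> U" "v \<notin> U"
    by (rule rtranclp_leaves_set[OF _ x y(2)])
  have vT: "v \<in> verts T" using adjacent_verts(2)[OF sT uv(1)] .
  have uniq: "w = u" if "w \<in> U" "adjacent T w v" for w
    using acyclic_unique_neighbour[OF sT acyc conn[OF uv(2) that(1)] uv(3,1) that(2) uv(2)] by simp
  \<comment> \<open>Since \<open>f u\<close> is not its own neighbour, at most \<open>n - 1\<close>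
    of its neighbours are occupied, while it has at least \<open>card (verts T) - 1 > n - 1\<close>.
    Counting \<open>f u\<close> as occupied would lose the strict inequality in the last
    round.\<close>
  have "card (f ` (U - {u})) < degree G (f u)"
  proof -
    have "card (f ` (U - {u})) \<le> n - 1"
      using card_image_le[of "U - {u}" f] finU U(2) uv(2) by simp
    moreover have "card (verts T) \<le> degree G (f u) + 1" using deg f(2) uv(2) by auto
    ultimately show ?thesis using step.hyps step.prems by linarith
  qed
  then have "\<not> {w \<in> verts G. adjacent G (f u) w} \<subseteq> f ` (U - {u})"
    using finU card_mono[of "f ` (U - {u})" "{w \<in> verts G. adjacent G w (f u)}"]
      adjacent_sym[of G] unfolding degree_def
    by (metis (mono_tags, lifting) Collect_cong finite_Diff finite_imageI leD)
  then obtain w where w: "w \<in> verts G" "adjacent G (f u) w" "w \<notin> f ` (U - {u})" by blast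
  then have wU: "w \<notin> f ` U" using adjacent_verts(3)[OF G(1) w(2)] by auto
  let ?U = "insert v U"
  define g where "g = f(v := w)"
  have gv: "g v = w" by (simp add: g_def)
  have gU: "g x = f x" if "x \<in> U" for x using that uv(3) by (auto simp: g_def)
  have lift: "(?R ?U)\<^sup>*\<^sup>* x y" if "x \<in> U" "y \<in> U" for x y
    using conn[OF that] by (rule rtranclp_mono[THEN predicate2D, rotated]) auto
  have edge: "(?R ?U) u v" "(?R ?U) v u" using uv adjacent_sym[OF uv(1)] by auto
  have "(?R ?U)\<^sup>*\<^sup>* x y" if "x \<in> ?U" "y \<in> ?U" for x y
  proof -
    have "(?R ?U)\<^sup>*\<^sup>* x u"
      using that(1) lift[OF _ uv(2)] edge(2) by blast
    moreover have "(?R ?U)\<^sup>*\<^sup>* u y"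
      using that(2) lift[OF uv(2)] edge(1) by blast
    ultimately show ?thesis by (rule rtranclp_trans)
  qed
  moreover have "inj_on g ?U" using f(1) wU gv gU uv(3) by (auto simp: inj_on_def image_iff)
  moreover have "g ` ?U \<subseteq> verts G" using f(2) w(1) gv gU by auto
  moreover have "adjacent G (g x) (g y)" if "x \<in> ?U" "y \<in> ?U" and a: "adjacent T x y" for x y
  proof -
    have "x \<noteq> y" using adjacent_verts(3)[OF sT a] .
    then consider "x \<in> U" "y \<in> U" | "x = v" "y \<in> U" | "x \<in> U" "y = v" using \<open>x \<in> ?U\<close> \<open>y \<in> ?U\<close> by auto
    then show ?thesis
    proof cases
      case 1
      then show ?thesis using hom a gU by simp
    next
      case 2
      then have "y = u" using uniq a adjacent_sym by metis
      then show ?thesis using 2 w(2) gv gU adjacent_sym by simp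
    next
      case 3
      then have "x = u" using uniq a by metis
      then show ?thesis using 3 w(2) gv gU by simp
    qed
  qed
  moreover have "card ?U = Suc n" using U finU uv(3) by simp
  ultimately show ?case using U(1) vT by (intro exI[of _ ?U] exI[of _ g]) auto
qed

text \<open>Adjacency is preserved in one direction only: the copy of the tree may be a non-induced
  subgraph.\<close>

lemma tree_embedding:
  assumes T: "tree T" and G: "simple_graph G" "verts G \<noteq> {}"
    and deg: "\<forall>v\<in>verts G. degree G v + 1 \<ge> card (verts T)"
  shows "\<exists>f. inj_on f (verts T) \<and> f ` verts T \<subseteq> verts G \<and>
    (\<forall>x y. adjacent T x y \<longrightarrow> adjacent G (f x) (f y))"
proof -
  have sT: "simple_graph T" and fin: "finite (verts T)" and ne: "verts T \<noteq> {}"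
    using T by (auto simp: tree_def simple_graph_def)
  then have "1 \<le> card (verts T)" by (simp add: Suc_leI card_gt_0_iff)
  from tree_embedding_partial[OF T G deg this order_refl] obtain U f where "U \<subseteq> verts T" "card U = card (verts T)" "inj_on f U" "f ` U \<subseteq> verts G"
      "\<forall>x\<in>U. \<forall>y\<in>U. adjacent T x y \<longrightarrow> adjacent G (f x) (f y)"
    by (elim exE conjE) (rule that)
  moreover from this fin have "U = verts T" by (simp add: card_subset_eq)
  ultimately show ?thesis using adjacent_verts(1,2)[OF sT] by (intro exI[of _ f]) auto
qed

section \<open>Isomorphic copies along an injection\<close>

definition map_graph :: "('a \<Rightarrow> 'b) \<Rightarrow> 'a ugraph \<Rightarrow> 'b ugraph" where
  "map_graph f G = (f ` verts G, (`) f ` edges G)"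

lemma adjacent_map_graph:
  assumes "simple_graph G" "inj_on f (verts G)" "u \<in> verts G" "v \<in> verts G"
  shows "adjacent (map_graph f G) (f u) (f v) \<longleftrightarrow> adjacent G u v"
proof -
  have "e = {u, v}" if "e \<in> edges G" "f ` e = {f u, f v}" for e
    using that assms inj_on_image_eq_iff[OF assms(2), of e "{u, v}"]
    by (simp add: simple_graph_def)
  then show ?thesis by (auto simp: adjacent_def map_graph_def image_iff)
qed

lemma simple_graph_map_graph:
  assumes "simple_graph G" "inj_on f (verts G)"
  shows "simple_graph (map_graph f G)"
  using assms
  by (auto simp: simple_graph_def map_graph_def card_image inj_on_subset)

lemma tree_map_graph:
  assumes T: "tree T" and inj: "inj_on f (verts T)"
  shows "tree (map_graph f T)"
proof -
  let ?T = "map_graph f T"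
  have sT: "simple_graph T" and ne: "verts T \<noteq> {}" using T by (auto simp: tree_def)
  note adj = adjacent_map_graph[OF sT inj]
  have vT: "verts ?T = f ` verts T" by (simp add: map_graph_def)
  have "(adjacent ?T)\<^sup>*\<^sup>* (f x) (f y)" if "(adjacent T)\<^sup>*\<^sup>* x y" for x y
    using that
  proof (induction rule: rtranclp_induct)
    case (step y z)
    then show ?case using adj adjacent_verts[OF sT step.hyps(2)]
      by (meson rtranclp.rtrancl_into_rtrancl)
  qed simp
  then have "graph_connected ?T"
    using T unfolding tree_def graph_connected_def vT by blast
  moreover have False if cyc: "cycle ?T vs" for vs
  proof -
    have "vs \<in> lists (f ` verts T)" using cyc vT by (auto simp: cycle_def)
    then obtain ws where ws: "set ws \<subseteq> verts T" "vs = map f ws"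
      by (auto simp: lists_image)
    have "ws \<noteq> []" using cyc ws by (auto simp: cycle_def)
    have "successively (adjacent T) ws"
      using cyc ws(1) unfolding cycle_iff_successively ws(2) successively_map
      by (auto elim: successively_mono simp: adj subset_iff)
    then have "cycle T ws"
      using cyc ws \<open>ws \<noteq> []\<close> adj[of "last ws" "hd ws"]
      by (auto simp: cycle_iff_successively hd_map last_map distinct_map subset_iff)
    then show False using T by (auto simp: tree_def)
  qed
  ultimately show ?thesis
    using simple_graph_map_graph[OF sT inj] ne vT by (auto simp: tree_def)
qed

lemma isomorphic_map_graph:
  assumes "simple_graph G" "inj_on f (verts G)"
  shows "isomorphic (map_graph f G) G"
  unfolding isomorphic_def
proof (intro exI conjI ballI)
  let ?g = "inv_into (verts G) f"
  show "bij_betw ?g (verts (map_graph f G)) (verts G)"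
    using assms(2) by (simp add: map_graph_def bij_betw_inv_into inj_on_imp_bij_betw)
  fix u v assume "u \<in> verts (map_graph f G)" "v \<in> verts (map_graph f G)"
  then show "adjacent (map_graph f G) u v \<longleftrightarrow> adjacent G (?g u) (?g v)"
    using adjacent_map_graph[OF assms] assms(2) by (auto simp: map_graph_def)
qed

section \<open>Splitting vertex sets of cographs\<close>

lemma adjacent_graph_union_left:
  assumes "simple_graph H" "verts G \<inter> verts H = {}" "u \<in> verts G"
  shows "adjacent (graph_union G H) u v \<longleftrightarrow> adjacent G u v"
  using assms adjacent_verts(1)[OF assms(1), of u v]
  by (auto simp: adjacent_def graph_union_def)

text \<open>Unlike for the union, both ends are required in \<open>G\<close>, because a vertex of
  \<open>G\<close> gains all of \<open>verts H\<close> as neighbours.\<close>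

lemma adjacent_graph_join_left:
  assumes "simple_graph H" "verts G \<inter> verts H = {}" "u \<in> verts G" "v \<in> verts G"
  shows "adjacent (graph_join G H) u v \<longleftrightarrow> adjacent G u v"
  using assms adjacent_verts(1)[OF assms(1), of u v]
  by (auto simp: adjacent_def graph_join_def doubleton_eq_iff)

lemma graph_union_commute: "graph_union G H = graph_union H G"
  by (auto simp: graph_union_def)

lemma graph_join_commute: "graph_join G H = graph_join H G"
  by (auto simp: graph_join_def insert_commute)

text \<open>The hereditary form of the definition: it spares us induced subgraphs of cographs.\<close>

lemma cograph_vertex_set_split:
  assumes "cograph G" "W \<subseteq> verts G" "card W \<ge> 2"
  shows "\<exists>X Y. X \<noteq> {} \<and> Y \<noteq> {} \<and> X \<inter> Y = {} \<and> X \<union> Y = W \<and>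
    ((\<forall>x\<in>X. \<forall>y\<in>Y. adjacent G x y) \<or> (\<forall>x\<in>X. \<forall>y\<in>Y. \<not> adjacent G x y))"
  using assms
proof (induction arbitrary: W)
  case (cograph_K1 v)
  then have "card W \<le> 1" using card_mono[of "{v}" W] by simp
  then show ?case using cograph_K1 by simp
next
  case (cograph_union G H)
  have s: "simple_graph G" "simple_graph H" using cograph_union.hyps(1,2)[THEN cograph_simple_graph] by blast+
  have d: "verts G \<inter> verts H = {}" "verts H \<inter> verts G = {}" using cograph_union.hyps by auto
  note l = adjacent_graph_union_left[OF s(2) d(1)]
  note r = adjacent_graph_union_left[OF s(1) d(2), folded graph_union_commute[of G H]]
  consider "W \<subseteq> verts G" | "W \<subseteq> verts H" | "W \<inter> verts G \<noteq> {}" "W \<inter> verts H \<noteq> {}"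
    using cograph_union.prems(1) by (auto simp: graph_union_def)
  then show ?case
  proof cases
    case 1
    obtain X Y where "X \<noteq> {}" "Y \<noteq> {}" "X \<inter> Y = {}" "X \<union> Y = W"
      "(\<forall>x\<in>X. \<forall>y\<in>Y. adjacent G x y) \<or> (\<forall>x\<in>X. \<forall>y\<in>Y. \<not> adjacent G x y)"
      using cograph_union.IH(1)[OF 1 cograph_union.prems(2)] by (elim exE conjE) (rule that)
    with 1 l show ?thesis by (intro exI[of _ X] exI[of _ Y]) (auto simp: subset_iff)
  next
    case 2
    obtain X Y where "X \<noteq> {}" "Y \<noteq> {}" "X \<inter> Y = {}" "X \<union> Y = W"
      "(\<forall>x\<in>X. \<forall>y\<in>Y. adjacent H x y) \<or> (\<forall>x\<in>X. \<forall>y\<in>Y. \<not> adjacent H x y)"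
      using cograph_union.IH(2)[OF 2 cograph_union.prems(2)] by (elim exE conjE) (rule that)
    with 2 r show ?thesis by (intro exI[of _ X] exI[of _ Y]) (auto simp: subset_iff)
  next
    \<comment> \<open>Here \<open>W\<close> meets both operands, and the operation itself supplies
      the split; otherwise the split is inherited from one operand.\<close>
    case 3
    have "\<not> adjacent (graph_union G H) x y" if "x \<in> W \<inter> verts G" "y \<in> W \<inter> verts H" for x y
      using that l adjacent_verts(2)[OF s(1)] d by auto
    with 3 d cograph_union.prems(1) show ?thesis
      by (intro exI[of _ "W \<inter> verts G"] exI[of _ "W \<inter> verts H"]) (auto simp: graph_union_def)
  qed
next
  case (cograph_join G H)
  have s: "simple_graph G" "simple_graph H" using cograph_join.hyps(1,2)[THEN cograph_simple_graph] by blast+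
  have d: "verts G \<inter> verts H = {}" "verts H \<inter> verts G = {}" using cograph_join.hyps by auto
  note l = adjacent_graph_join_left[OF s(2) d(1)]
  note r = adjacent_graph_join_left[OF s(1) d(2), folded graph_join_commute[of G H]]
  consider "W \<subseteq> verts G" | "W \<subseteq> verts H" | "W \<inter> verts G \<noteq> {}" "W \<inter> verts H \<noteq> {}"
    using cograph_join.prems(1) by (auto simp: graph_join_def)
  then show ?case
  proof cases
    case 1
    obtain X Y where "X \<noteq> {}" "Y \<noteq> {}" "X \<inter> Y = {}" "X \<union> Y = W"
      "(\<forall>x\<in>X. \<forall>y\<in>Y. adjacent G x y) \<or> (\<forall>x\<in>X. \<forall>y\<in>Y. \<not> adjacent G x y)"
      using cograph_join.IH(1)[OF 1 cograph_join.prems(2)] by (elim exE conjE) (rule that)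
    with 1 l show ?thesis by (intro exI[of _ X] exI[of _ Y]) (auto simp: subset_iff)
  next
    case 2
    obtain X Y where "X \<noteq> {}" "Y \<noteq> {}" "X \<inter> Y = {}" "X \<union> Y = W"
      "(\<forall>x\<in>X. \<forall>y\<in>Y. adjacent H x y) \<or> (\<forall>x\<in>X. \<forall>y\<in>Y. \<not> adjacent H x y)"
      using cograph_join.IH(2)[OF 2 cograph_join.prems(2)] by (elim exE conjE) (rule that)
    with 2 r show ?thesis by (intro exI[of _ X] exI[of _ Y]) (auto simp: subset_iff)
  next
    case 3
    have "adjacent (graph_join G H) x y" if "x \<in> W \<inter> verts G" "y \<in> W \<inter> verts H" for x y
      using that by (auto simp: adjacent_def graph_join_def)
    with 3 d cograph_join.prems(1) show ?thesis
      by (intro exI[of _ "W \<inter> verts G"] exI[of _ "W \<inter> verts H"]) (auto simp: graph_join_def)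
  qed
qed

section \<open>Cuts and connectivity\<close>

lemma not_connected_split:
  assumes "\<not> graph_connected H"
  shows "\<exists>A B. A \<noteq> {} \<and> B \<noteq> {} \<and> A \<inter> B = {} \<and> A \<union> B = verts H \<and>
    (\<forall>a\<in>A. \<forall>b\<in>B. \<not> adjacent H a b)"
proof -
  obtain u v where uv: "u \<in> verts H" "v \<in> verts H" "\<not> (adjacent H)\<^sup>*\<^sup>* u v"
    using assms by (auto simp: graph_connected_def)
  let ?A = "{w \<in> verts H. (adjacent H)\<^sup>*\<^sup>* u w}"
  have "\<forall>a\<in>?A. \<forall>b\<in>verts H - ?A. \<not> adjacent H a b"
    by (auto intro: rtranclp.rtrancl_into_rtrancl)
  moreover have "u \<in> ?A" "v \<in> verts H - ?A" using uv by auto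
  ultimately show ?thesis by (intro exI[of _ ?A] exI[of _ "verts H - ?A"]) blast
qed

lemma connected_cut_edge:
  assumes "graph_connected H" "verts H = X \<union> Y" "X \<noteq> {}" "Y \<noteq> {}" "X \<inter> Y = {}"
    and H: "simple_graph H"
  shows "\<exists>x\<in>X. \<exists>y\<in>Y. adjacent H x y"
proof -
  obtain x y where "x \<in> X" "y \<in> Y" using assms by blast
  with assms have "(adjacent H)\<^sup>*\<^sup>* x y" "x \<in> X" "y \<notin> X" by (auto simp: graph_connected_def)
  then obtain u v where "adjacent H u v" "u \<in> X" "v \<notin> X" by (rule rtranclp_leaves_set)
  then show ?thesis using adjacent_verts(2)[OF H] assms(2) by blast
qed

lemma connectivity_ge_iff:
  assumes "finite (verts G)" "verts G \<noteq> {}"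
  shows "connectivity G \<ge> k \<longleftrightarrow> (\<forall>S \<subseteq> verts G. card S < k \<longrightarrow>
    graph_connected (delete_verts G S) \<and> card (verts (delete_verts G S)) \<noteq> 1)"
    (is "_ \<longleftrightarrow> ?rhs")
proof -
  let ?P = "\<lambda>n. \<exists>S \<subseteq> verts G. card S = n \<and>
     (\<not> graph_connected (delete_verts G S) \<or> card (verts (delete_verts G S)) = 1)"
  obtain v where v: "v \<in> verts G" using assms(2) by blast
  \<comment> \<open>Deleting all vertices but one is admissible in the definition, so the
    \<open>LEAST\<close> is attained.\<close>
  have "verts G - (verts G - {v}) = {v}" using v by blast
  then have "?P (card (verts G - {v}))"
    by (intro exI[of _ "verts G - {v}"]) (auto simp: delete_verts_def)
  then have P: "?P (connectivity G)"
    unfolding connectivity_def by (rule LeastI)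
  have least: "connectivity G \<le> n" if "?P n" for n
    unfolding connectivity_def using that by (rule Least_le)
  show ?thesis
  proof
    assume k: "k \<le> connectivity G"
    show ?rhs
    proof (intro allI impI)
      fix S assume "S \<subseteq> verts G" "card S < k"
      then show "graph_connected (delete_verts G S) \<and> card (verts (delete_verts G S)) \<noteq> 1"
        using least[of "card S"] k by auto
    qed
  next
    assume ?rhs
    then show "k \<le> connectivity G" using P by (metis not_le)
  qed
qed

section \<open>Deleting the edges of the tree copy\<close>

text \<open>The graph \<open>K\<close> stands for the copy of the tree, of which only the order matters here.\<close>

lemma connected_cograph_delete_edges:
  assumes G: "cograph G" and K: "simple_graph K"
    and deg: "\<And>v. v \<in> verts G \<Longrightarrow> degree G v \<ge> card S + card (verts K)"
    and S: "S \<subseteq> verts G" and conn: "graph_connected (delete_verts G S)"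
  shows "graph_connected (delete_verts (delete_edges G (edges K)) S)" (is "graph_connected ?H")
proof (rule ccontr)
  assume "\<not> graph_connected ?H"
  moreover have "verts ?H = verts G - S" by (simp add: delete_verts_def delete_edges_def)
  ultimately obtain A B where AB: "A \<noteq> {}" "B \<noteq> {}" "A \<inter> B = {}" "A \<union> B = verts G - S"
      and noedge: "\<And>a b. a \<in> A \<Longrightarrow> b \<in> B \<Longrightarrow> \<not> adjacent ?H a b"
    using not_connected_split[of ?H] by metis
  have sG: "simple_graph G" using G cograph_simple_graph by blast
  then have finG: "finite (verts G)" by (simp add: simple_graph_def)
  have finK: "finite (verts K)" using K by (simp add: simple_graph_def)
  \<comment> \<open>Both ends avoid \<open>S\<close>, so an edge of \<open>G\<close> missing from
    \<open>?H\<close> can only have been deleted as an edge of \<open>K\<close>.\<close>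
  have cross: "adjacent K a b" if "a \<in> A" "b \<in> B" "adjacent G a b" for a b
    using noedge[OF that(1,2)] that AB(4)
    by (auto simp: adjacent_delete_verts) (auto simp: adjacent_def delete_edges_def)
  \<comment> \<open>Stated for arbitrary \<open>C\<close> and \<open>D\<close> so that it serves
    both sides of the cut.\<close>
  have outside: "\<exists>a\<in>C. a \<notin> verts K"
    if C: "C \<noteq> {}" "C \<union> D = verts G - S"
      and cr: "\<And>a b. a \<in> C \<Longrightarrow> b \<in> D \<Longrightarrow> adjacent G a b \<Longrightarrow> adjacent K a b" for C D
  proof (rule ccontr)
    assume "\<not> (\<exists>a\<in>C. a \<notin> verts K)"
    then have sub: "C \<subseteq> verts K" by blast
    obtain x where x: "x \<in> C" using C by blast
    \<comment> \<open>A neighbour in \<open>C\<close> lies in \<open>K\<close> by assumption, one in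
      \<open>D\<close> because the edge to it belongs to \<open>K\<close>. Leaving out
      \<open>x\<close> makes the degree bound below strict.\<close>
    have "{u \<in> verts G. adjacent G u x} \<subseteq> S \<union> (verts K - {x})"
    proof
      fix u assume "u \<in> {u \<in> verts G. adjacent G u x}"
      then have u: "u \<in> verts G" "adjacent G x u" "u \<noteq> x"
        using adjacent_sym[of G u x] adjacent_verts(3)[OF sG] by auto
      then consider "u \<in> S" | "u \<in> C" | "u \<in> D" using C(2) by blast
      then show "u \<in> S \<union> (verts K - {x})"
      proof cases
        case 3
        then show ?thesis using cr[OF x] u adjacent_verts(2)[OF K] by blast
      qed (use sub u in auto)
    qed
    then have "degree G x \<le> card (S \<union> (verts K - {x}))"
      unfolding degree_def using finK finite_subset[OF S finG] by (intro card_mono) auto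
    also have "\<dots> \<le> card S + card (verts K - {x})" by (rule card_Un_le)
    also have "\<dots> < card S + card (verts K)"
      using finK x sub by (intro add_strict_left_mono card_Diff1_less) auto
    finally show False using deg[of x] x C(2) by auto
  qed
  obtain a where a: "a \<in> A" "a \<notin> verts K" using outside[OF AB(1,4) cross] by blast
  have "\<And>a b. a \<in> B \<Longrightarrow> b \<in> A \<Longrightarrow> adjacent G a b \<Longrightarrow> adjacent K a b"
    using cross adjacent_sym by metis
  then obtain b where b: "b \<in> B" "b \<notin> verts K" using outside[of B A] AB by blast
  have na: "\<not> adjacent G a y" if "y \<in> B" for y
    using cross[OF a(1) that] adjacent_verts(1)[OF K] a(2) by blast
  have nb: "\<not> adjacent G b y" if "y \<in> A" for y
    using cross[OF that b(1)] adjacent_verts(2)[OF K] b(2) adjacent_sym by metis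
  have "card {a, b} \<le> card (verts G - S)" using finG AB a b by (intro card_mono) auto
  moreover have "a \<noteq> b" using a b AB by blast
  ultimately have "card (verts G - S) \<ge> 2" by simp
  then obtain X Y where XY: "X \<noteq> {}" "Y \<noteq> {}" "X \<inter> Y = {}" "X \<union> Y = verts G - S"
    and split: "(\<forall>x\<in>X. \<forall>y\<in>Y. adjacent G x y) \<or> (\<forall>x\<in>X. \<forall>y\<in>Y. \<not> adjacent G x y)"
    using cograph_vertex_set_split[OF G, of "verts G - S"] by blast
  have "simple_graph (delete_verts G S)"
    using sG by (auto simp: simple_graph_def delete_verts_def)
  \<comment> \<open>Connectedness of \<open>G - S\<close> rules out the edgeless alternative of the
    split.\<close>
  then have "\<exists>x\<in>X. \<exists>y\<in>Y. adjacent G x y"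
    using connected_cut_edge[OF conn, of X Y] XY
    by (auto simp: adjacent_delete_verts) (auto simp: delete_verts_def)
  with split have join: "\<And>x y. x \<in> X \<Longrightarrow> y \<in> Y \<Longrightarrow> adjacent G x y" by blast
  \<comment> \<open>As \<open>a\<close> is adjacent to all of \<open>Q\<close> but to nothing in
    \<open>B\<close>, the set \<open>Q\<close> lies in \<open>A\<close>. Hence \<open>b\<close> is
    in \<open>P\<close> and adjacent to some vertex of \<open>A\<close>, against
    \<open>nb\<close>.\<close>
  have absurd: False if "a \<in> P" "P \<union> Q = verts G - S" "Q \<noteq> {}"
    and "\<And>x y. x \<in> P \<Longrightarrow> y \<in> Q \<Longrightarrow> adjacent G x y" for P Q
    using that AB(4) na nb a(1) b(1) adjacent_sym by (metis UnE UnI2 ex_in_conv)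
  have "a \<in> X \<or> a \<in> Y" using XY(4) a(1) AB(4) by blast
  then show False
  proof
    assume "a \<in> X"
    then show False using XY(4,2) join by (rule absurd)
  next
    assume "a \<in> Y"
    moreover have "Y \<union> X = verts G - S" using XY(4) by blast
    ultimately show False using XY(1) join[THEN adjacent_sym] by (rule absurd)
  qed
qed

theorem theorem10:
  fixes k m :: nat and T :: "'b ugraph" and G :: "'a ugraph"
  assumes "k \<ge> 1" and "m \<ge> 1"
    and "tree T" and "card (verts T) = m"
    and "cograph G" and "k_connected k G"
    and "min_degree G \<ge> k + m - 1"
  shows "\<exists>T'. tree T' \<and> subgraph T' G \<and> isomorphic T' T \<and>
           k_connected k (delete_edges G (edges T'))"
proof -
  have sG: "simple_graph G" and ne: "verts G \<noteq> {}" using cograph_simple_graph[OF assms(5)] by blast+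
  have fin: "finite (verts G)" using sG by (simp add: simple_graph_def)
  have sT: "simple_graph T" using assms(3) by (simp add: tree_def)
  have deg: "degree G v \<ge> k + m - 1" if "v \<in> verts G" for v
    using assms(7) that fin unfolding min_degree_def by (meson Min_le finite_imageI image_eqI le_trans)
  \<comment> \<open>This bound excludes the \<open>K_1\<close> convention in
    \<open>k_connected\<close>, and it leaves at least \<open>m + 1\<close> vertices, hence more
    than one, after deleting fewer than \<open>k\<close>.\<close>
  have order: "card (verts G) \<ge> k + m"
  proof -
    obtain v where v: "v \<in> verts G" using ne by blast
    have "degree G v \<le> card (verts G - {v})"
      unfolding degree_def using fin adjacent_verts(3)[OF sG] by (intro card_mono) auto
    also have "\<dots> < card (verts G)" using fin v by (rule card_Diff1_less)
    finally show ?thesis using deg[OF v] by linarith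
  qed
  then have "connectivity G \<ge> k" using assms(1,2,6) by (auto simp: k_connected_def)
  then have conn: "graph_connected (delete_verts G S)" if "S \<subseteq> verts G" "card S < k" for S
    using that connectivity_ge_iff[OF fin ne] by blast
  have "\<forall>v\<in>verts G. degree G v + 1 \<ge> card (verts T)"
  proof
    fix v assume "v \<in> verts G"
    then show "degree G v + 1 \<ge> card (verts T)" using deg[of v] assms(1,4) by linarith
  qed
  then obtain f where f: "inj_on f (verts T)" "f ` verts T \<subseteq> verts G"
      "\<And>x y. adjacent T x y \<Longrightarrow> adjacent G (f x) (f y)"
    using tree_embedding[OF assms(3) sG ne] by blast
  let ?T = "map_graph f T"
  have sT': "simple_graph ?T" by (rule simple_graph_map_graph[OF sT f(1)])
  have cT': "card (verts ?T) = m" using assms(4) f(1) by (simp add: map_graph_def card_image)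
  have "f ` e \<in> edges G" if "e \<in> edges T" for e
  proof -
    have "card e = 2" using that sT by (simp add: simple_graph_def)
    then obtain x y where "e = {x, y}" by (auto simp: card_2_iff)
    then show ?thesis using f(3)[of x y] that by (simp add: adjacent_def)
  qed
  then have "subgraph ?T G" using f(2) by (auto simp: subgraph_def map_graph_def)
  moreover have "k_connected k (delete_edges G (edges ?T))"
  proof -
    have "graph_connected (delete_verts (delete_edges G (edges ?T)) S) \<and> card (verts G - S) \<noteq> 1"
      if S: "S \<subseteq> verts G" "card S < k" for S
    proof
      \<comment> \<open>From \<open>card S \<le> k - 1\<close> the left side is at most
        \<open>k + m - 1\<close>, exactly the assumed minimum degree.\<close>
      have "card S + card (verts ?T) \<le> degree G v" if "v \<in> verts G" for v
        using deg[OF that] S(2) cT' by linarith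
      then show "graph_connected (delete_verts (delete_edges G (edges ?T)) S)"
        by (rule connected_cograph_delete_edges[OF assms(5) sT' _ S(1) conn[OF S]])
      show "card (verts G - S) \<noteq> 1"
        using order S assms(2) fin finite_subset[OF S(1) fin] by (simp add: card_Diff_subset)
    qed
    then show ?thesis
      using fin ne connectivity_ge_iff[of "delete_edges G (edges ?T)" k]
      by (auto simp: k_connected_def delete_edges_def delete_verts_def)
  qed
  ultimately show ?thesis
    using tree_map_graph[OF assms(3) f(1)] isomorphic_map_graph[OF sT f(1)] by blast
qed

end
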